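(* Let $(\mathbf{x}_k,\mathbf{y}_k)_{k\ge 1}$ be the iterates of the algorithm FWLP-P described in the context, started from $\mathbf{x}_1\in\mathbb{R}^n$, $\mathbf{x}_1\ge\mathbf{0}$, and $\mathbf{y}_1\in\mathbb{R}^m$. Then FWLP-P reaches an $\epsilon$-optimal solution of the primal linear program and its dual after $O(1/\epsilon^2)$ iterations; that is, there is a constant $K>0$, depending only on $A,\mathbf{b},\mathbf{c},\xi,\eta,\mathbf{x}_1,\mathbf{y}_1$, such that for every $\epsilon\in(0,1]$ and every integer $k\ge K/\epsilon^2$ the pair $(\mathbf{x}_k,\mathbf{y}_k)$ is $\epsilon$-optimal.
   Context: Let $A\in\mathbb{R}^{m\times n}$, $\mathbf{b}\in\mathbb{R}^m$, $\mathbf{c}\in\mathbb{R}^n$. The primal linear program is $\min\{\mathbf{c}^\top\mathbf{x}: A\mathbf{x}=\mathbf{b},\ \mathbf{x}\ge\mathbf{0}\}$ and its dual is $\max\{\mathbf{b}^\top\mathbf{y}: A^\top\mathbf{y}\le\mathbf{c}\}$; the primal is assumed to have an optimal solution, and $(\mathbf{x}^*,\mathbf{y}^* )$ denotes an optimal primal-dual pair. The parameters $\xi,\eta>0$ satisfy $\xi\ge 2\Vert\mathbf{x}^*\Vert_1$ and $\eta\ge 2\Vert\mathbf{y}^*\Vert_\infty$. Set $\Delta=\{\mathbf{x}\in\mathbb{R}^n:\mathbf{x}\ge\mathbf{0},\ \mathbf{e}^\top\mathbf{x}\le\xi\}$, where $\mathbf{e}$ is the all-ones vector, and $\Gamma=[-\eta,\eta]^m$.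 Unsubscripted $\Vert\cdot\Vert$ is the Euclidean norm; $\mathbf{e}_j$ is the $j$th column of the identity matrix. A pair $(\mathbf{x},\mathbf{y})\in\mathbb{R}^n\times\mathbb{R}^m$ is called $\epsilon$-optimal if $\mathbf{x}\ge\mathbf{0}$, $\Vert\mathbf{b}-A\mathbf{x}\Vert_1\le\epsilon$, $\max(0,\max_{1\le j\le n}\mathbf{e}_j^\top(A^\top\mathbf{y}-\mathbf{c}))\le\epsilon$, and $\mathbf{c}^\top\mathbf{x}-\mathbf{b}^\top\mathbf{y}\le\epsilon$. Algorithm FWLP-P: given starting points $\mathbf{x}_1,\mathbf{y}_1$, for $k=1,2,\dots$ compute $$\mathbf{r}_{k+1} := \operatorname{argmin}_{\mathbf{r}\in\Delta}\Big\{(\mathbf{c}-A^\top\mathbf{y}_k)^\top\mathbf{r} + \tfrac{\Vert \mathbf{r}\Vert^2}{2\sqrt{k}}\Big\},\qquad \mathbf{x}_{k+1}:=\tfrac{k}{k+1}\mathbf{x}_k + \tfrac{1}{k+1}\mathbf{r}_{k+1},$$ $$\mathbf{s}_{k+1}:=\operatorname{argmax}_{\mathbf{s}\in\Gamma}\Big\{(\mathbf{b}-A\mathbf{x}_{k+1})^\top\mathbf{s} -\tfrac{\Vert\mathbf{s}\Vert^2}{2\sqrt{k}}\Big\},\qquad \mathbf{y}_{k+1}:=\tfrac{k}{k+1}\mathbf{y}_k+\tfrac{1}{k+1}\mathbf{s}_{k+1}.$$ *)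

theory Defs
  imports "HOL-Analysis.Analysis"
begin

text \<open>
  A matrix with rows indexed by \<^typ>\<open>'m\<close> and columns indexed by \<^typ>\<open>'n\<close> has type
  \<^typ>\<open>real^'n^'m\<close>. The order on vectors is the library's componentwise order, and the
  maximum norm is the library's \<^const>\<open>infnorm\<close>.
\<close>

definition norm1 :: "real^'n \<Rightarrow> real" where
  "norm1 v = (\<Sum>i\<in>UNIV. \<bar>v $ i\<bar>)"

definition primal_feasible :: "real^'n^'m \<Rightarrow> real^'m \<Rightarrow> (real^'n) set" where
  "primal_feasible A b = {x. A *v x = b \<and> 0 \<le> x}"

definition dual_feasible :: "real^'n^'m \<Rightarrow> real^'n \<Rightarrow> (real^'m) set" where
  "dual_feasible A c = {y. transpose A *v y \<le> c}"

definition optimal_pair ::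
  "real^'n^'m \<Rightarrow> real^'m \<Rightarrow> real^'n \<Rightarrow> real^'n \<Rightarrow> real^'m \<Rightarrow> bool" where
  "optimal_pair A b c x y \<longleftrightarrow>
     is_arg_min (\<lambda>x. c \<bullet> x) (\<lambda>x. x \<in> primal_feasible A b) x \<and>
     is_arg_max (\<lambda>y. b \<bullet> y) (\<lambda>y. y \<in> dual_feasible A c) y"

definition eps_optimal ::
  "real^'n^'m \<Rightarrow> real^'m \<Rightarrow> real^'n \<Rightarrow> real \<Rightarrow> real^'n \<Rightarrow> real^'m \<Rightarrow> bool" where
  "eps_optimal A b c \<epsilon> x y \<longleftrightarrow>
     0 \<le> x \<and>
     norm1 (b - A *v x) \<le> \<epsilon> \<and>
     max 0 (MAX j. axis j 1 \<bullet> (transpose A *v y - c)) \<le> \<epsilon> \<and>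
     c \<bullet> x - b \<bullet> y \<le> \<epsilon>"

definition Delta :: "real \<Rightarrow> (real^'n) set" where
  "Delta \<xi> = {x. 0 \<le> x \<and> vec 1 \<bullet> x \<le> \<xi>}"

definition Gamma_box :: "real \<Rightarrow> (real^'m) set" where
  "Gamma_box \<eta> = cbox (vec (- \<eta>)) (vec \<eta>)"

text \<open>
  The sequences are indexed from 1 (\<open>x\<close>, \<open>y\<close>) and from 2 (\<open>r\<close>, \<open>s\<close>); entries at smaller
  indices are irrelevant. Both objectives are strictly convex, respectively strictly concave,
  on a nonempty compact set (for positive \<open>\<xi>\<close> and \<open>\<eta>\<close>), so the starting points
  \<open>x 1\<close> and \<open>y 1\<close> determine the sequences.
\<close>
definition fwlp_p_iterates ::
  "real^'n^'m \<Rightarrow> real^'m \<Rightarrow> real^'n \<Rightarrow> real \<Rightarrow> real \<Rightarrow>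
   (nat \<Rightarrow> real^'n) \<Rightarrow> (nat \<Rightarrow> real^'m) \<Rightarrow> (nat \<Rightarrow> real^'n) \<Rightarrow> (nat \<Rightarrow> real^'m) \<Rightarrow> bool" where
  "fwlp_p_iterates A b c \<xi> \<eta> x y r s \<longleftrightarrow>
     (\<forall>k\<ge>1.
        is_arg_min (\<lambda>u. (c - transpose A *v y k) \<bullet> u + (norm u)\<^sup>2 / (2 * sqrt (real k)))
          (\<lambda>u. u \<in> Delta \<xi>) (r (k + 1)) \<and>
        x (k + 1) = (real k / real (k + 1)) *\<^sub>R x k + (1 / real (k + 1)) *\<^sub>R r (k + 1) \<and>
        is_arg_max (\<lambda>u. (b - A *v x (k + 1)) \<bullet> u - (norm u)\<^sup>2 / (2 * sqrt (real k)))
          (\<lambda>u. u \<in> Gamma_box \<eta>) (s (k + 1)) \<and>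
        y (k + 1) = (real k / real (k + 1)) *\<^sub>R y k + (1 / real (k + 1)) *\<^sub>R s (k + 1))"

end

theory Submission
  imports Defs
begin

text \<open>
  Let \<open>L(x, y) = c \<bullet> x + b \<bullet> y - y \<bullet> A x\<close> be the Lagrangian of the linear program. The
  proof is about the gap
  \<open>sup {L(x, v) - L(u, y) | u \<in> \<Delta>, v \<in> \<Gamma>}\<close>. Taking the suprema gives its value
  \<open>c \<bullet> x - b \<bullet> y + \<eta> \<parallel>b - A x\<parallel>\<^sub>1 + \<xi> V(y)\<close>, where \<open>V(y)\<close> is the
  largest violation of a dual constraint: an exact penalty function.

  A small gap implies approximate optimality (\<open>eps_optimal_if_gap_le\<close>). By strong duality the
  true duality gap \<open>c \<bullet> x - b \<bullet> y\<close> of an infeasible pair can be negative only by an amount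
  controlled by the infeasibilities, with the optimal solutions as multipliers. The factor 2
  between \<open>\<xi>\<close>, \<open>\<eta>\<close> and the norms of these solutions makes that amount at most half of the
  penalty terms, so the other half is bounded by the gap.

  The gap at the \<open>k\<close>-th iterate is \<open>O(1 / \<surd>k)\<close> (\<open>fwlp_p_gap\<close>). Multiplying the two
  subproblems by \<open>k\<close> and \<open>k + 1\<close> exposes the algorithm as regularized leader following: since
  \<open>k x\<^sub>k\<close> and \<open>k y\<^sub>k\<close> add up the starting point and the later choices, \<open>r\<^sub>k\<^sub>+\<^sub>1\<close> minimizes the
  accumulated linear costs plus \<open>\<surd>k / 2 \<parallel>\<cdot>\<parallel>\<^sup>2\<close>, and \<open>s\<^sub>k\<^sub>+\<^sub>1\<close> maximizes the accumulated
  linear gains, those of \<open>r\<^sub>k\<^sub>+\<^sub>1\<close> included, minus a comparable regularizer. The potential is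
  \<open>k\<close> times the regularized gap. In one step the dual player, who moves knowing
  \<open>r\<^sub>k\<^sub>+\<^sub>1\<close>, adds nothing beyond \<open>L(r\<^sub>k\<^sub>+\<^sub>1, s\<^sub>k\<^sub>+\<^sub>1)\<close>. The primal player
  loses only \<open>L(r\<^sub>k\<^sub>+\<^sub>1, s\<^sub>k\<^sub>+\<^sub>1) - L(r\<^sub>k\<^sub>+\<^sub>2, s\<^sub>k\<^sub>+\<^sub>1)\<close>, which is linear in the
  displacement, while strong convexity gains \<open>\<surd>k / 2\<close> times its square. The net growth is
  \<open>O(1 / \<surd>k)\<close> per step, hence the potential is \<open>O(\<surd>k)\<close> (\<open>fwlp_p_potential\<close>), the
  regularizers contribute another \<open>O(\<surd>k)\<close>, and division by \<open>k\<close> gives the rate.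
\<close>

section \<open>Strong duality of linear programming\<close>

lemma inner_transpose_matrix_vector:
  fixes A :: "real^'n^'m"
  shows "(transpose A *v y) \<bullet> x = y \<bullet> (A *v x)"
  by (simp add: dot_lmul_matrix)

lemma inner_nonneg_vec:
  fixes u v :: "real^'n"
  assumes "0 \<le> u" "0 \<le> v"
  shows "0 \<le> u \<bullet> v"
  using assms by (auto simp: inner_vec_def less_eq_vec_def intro!: sum_nonneg)

lemma convex_cone_attainable_costs:
  fixes A :: "real^'n^'m" and c :: "real^'n"
  shows "convex_cone {(z, t). \<exists>x\<ge>0. A *v x = z \<and> c \<bullet> x \<le> t}"
  unfolding convex_cone_iff
proof (intro conjI ballI allI impI)
  show "0 \<in> {(z, t). \<exists>x\<ge>0. A *v x = z \<and> c \<bullet> x \<le> t}"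
    by (auto simp: zero_prod_def intro!: exI[of _ 0])
next
  fix p q
  assume "p \<in> {(z, t). \<exists>x\<ge>0. A *v x = z \<and> c \<bullet> x \<le> t}"
    and "q \<in> {(z, t). \<exists>x\<ge>0. A *v x = z \<and> c \<bullet> x \<le> t}"
  then obtain x x' where x: "0 \<le> x" "A *v x = fst p" "c \<bullet> x \<le> snd p"
    and x': "0 \<le> x'" "A *v x' = fst q" "c \<bullet> x' \<le> snd q"
    by (auto simp: case_prod_beta)
  have "0 \<le> x + x'" "A *v (x + x') = fst (p + q)" "c \<bullet> (x + x') \<le> snd (p + q)"
    using x x' by (auto simp: matrix_vector_right_distrib inner_add_right less_eq_vec_def)
  then show "p + q \<in> {(z, t). \<exists>x\<ge>0. A *v x = z \<and> c \<bullet> x \<le> t}"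
    by (auto simp: case_prod_beta)
next
  fix p and a :: real
  assume "p \<in> {(z, t). \<exists>x\<ge>0. A *v x = z \<and> c \<bullet> x \<le> t}" and a: "0 \<le> a"
  then obtain x where x: "0 \<le> x" "A *v x = fst p" "c \<bullet> x \<le> snd p"
    by (auto simp: case_prod_beta)
  have "0 \<le> a *\<^sub>R x" "A *v (a *\<^sub>R x) = fst (a *\<^sub>R p)" "c \<bullet> (a *\<^sub>R x) \<le> snd (a *\<^sub>R p)"
    using x a by (auto simp: matrix_vector_mult_scaleR less_eq_vec_def mult_left_mono)
  then show "a *\<^sub>R p \<in> {(z, t). \<exists>x\<ge>0. A *v x = z \<and> c \<bullet> x \<le> t}"
    by (auto simp: case_prod_beta)
qed

text \<open>
  The point \<open>(b, v)\<close> lies outside the set of the previous lemma, since no feasible point costs as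
  little as \<open>v\<close>. A hyperplane separating it from the cone yields a dual solution of value above
  \<open>v\<close>. Separation requires a closed cone; the finitely generated subcone spanned by the columns of
  the program is closed, and it suffices because nonnegative combinations of the columns recover
  every \<open>(A x, c \<bullet> x)\<close>.
\<close>
lemma dual_feasible_above_lower_value:
  fixes A :: "real^'n^'m" and b :: "real^'m" and c x :: "real^'n"
  assumes min: "is_arg_min (\<lambda>x. c \<bullet> x) (\<lambda>x. x \<in> primal_feasible A b) x"
    and v: "v < c \<bullet> x"
  shows "\<exists>y\<in>dual_feasible A c. v < b \<bullet> y"
proof -
  have x: "0 \<le> x" "A *v x = b"
    and opt: "\<And>x'. 0 \<le> x' \<Longrightarrow> A *v x' = b \<Longrightarrow> c \<bullet> x \<le> c \<bullet> x'"
    using min by (auto simp: is_arg_min_linorder primal_feasible_def)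
  define W where "W = {(z, t). \<exists>x\<ge>0. A *v x = z \<and> c \<bullet> x \<le> t}"
  define G where "G = insert (0, 1) (range (\<lambda>j. (A *v axis j 1, c $ j)))"
  have "G \<subseteq> W"
  proof -
    have "(0, 1) \<in> W"
      by (auto simp: W_def intro!: exI[of _ 0])
    moreover have "(A *v axis j 1, c $ j) \<in> W" for j
      by (auto simp: W_def less_eq_vec_def axis_def inner_axis intro!: exI[of _ "axis j 1"])
         (metis axis_def inner_axis inner_real_def mult.right_neutral order_refl)
    ultimately show ?thesis
      by (auto simp: G_def)
  qed
  then have "convex_cone hull G \<subseteq> W"
    unfolding W_def by (intro hull_minimal convex_cone_attainable_costs)
  moreover have "(b, v) \<notin> W"
    using opt v by (force simp: W_def)
  ultimately have out: "(b, v) \<notin> convex_cone hull G"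
    by blast
  have "finite G"
    by (simp add: G_def)
  then have "closed (convex_cone hull G)"
    by (rule closed_convex_cone_hull)
  then obtain a \<beta> where lt: "a \<bullet> (b, v) < \<beta>" and gt: "\<And>z. z \<in> convex_cone hull G \<Longrightarrow> \<beta> < a \<bullet> z"
    using separating_hyperplane_closed_point[OF convex_convex_cone_hull _ out] by blast
  have \<beta>: "\<beta> < 0"
    using gt[OF convex_cone_hull_contains_0] by simp
  \<comment> \<open>A generator with negative product could be scaled until it meets the hyperplane.\<close>
  have nonneg: "0 \<le> a \<bullet> g" if "g \<in> G" for g
  proof (rule ccontr)
    assume neg: "\<not> 0 \<le> a \<bullet> g"
    have "(\<beta> / (a \<bullet> g)) *\<^sub>R g \<in> convex_cone hull G"
      using that neg \<beta> by (intro convex_cone_hull_mul hull_inc) (auto simp: divide_nonpos_neg)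
    from gt[OF this] show False
      using neg by simp
  qed
  obtain w t where a: "a = (w, t)"
    by (cases a)
  have t: "0 \<le> t"
    using nonneg[of "(0, 1)"] by (simp add: G_def a inner_prod_def)
  have red: "0 \<le> transpose A *v w + t *\<^sub>R c"
  proof -
    have "0 \<le> (transpose A *v w + t *\<^sub>R c) $ j" for j
    proof -
      have "0 \<le> a \<bullet> (A *v axis j 1, c $ j)"
        by (intro nonneg) (simp add: G_def)
      also have "\<dots> = (transpose A *v w) \<bullet> axis j 1 + t * c $ j"
        unfolding inner_transpose_matrix_vector by (simp add: a inner_prod_def)
      finally show ?thesis
        by (simp add: inner_axis)
    qed
    then show ?thesis
      by (simp add: less_eq_vec_def)
  qed
  have "0 \<le> (transpose A *v w + t *\<^sub>R c) \<bullet> x"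
    using red x(1) by (rule inner_nonneg_vec)
  also have "\<dots> = w \<bullet> b + t * (c \<bullet> x)"
    using x(2) inner_transpose_matrix_vector[of A w x] by (simp add: inner_add_left)
  finally have ge: "0 \<le> w \<bullet> b + t * (c \<bullet> x)" .
  have less: "w \<bullet> b + t * v < 0"
    using lt \<beta> by (simp add: a inner_prod_def)
  \<comment> \<open>The primal solution excludes a vertical hyperplane.\<close>
  have "t \<noteq> 0"
    using ge less by auto
  with t have t: "0 < t"
    by simp
  define y where "y = (- 1 / t) *\<^sub>R w"
  have "transpose A *v y \<le> c"
  proof -
    have "(transpose A *v y) $ j \<le> c $ j" for j
    proof -
      have "(transpose A *v y) $ j = - (transpose A *v w) $ j / t"
        unfolding y_def matrix_vector_mult_scaleR by simp
      also have "\<dots> \<le> c $ j"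
        using spec[OF red[unfolded less_eq_vec_def], of j] t
        by (subst pos_divide_le_eq) (simp_all add: mult.commute)
      finally show ?thesis .
    qed
    then show ?thesis
      by (simp add: less_eq_vec_def)
  qed
  moreover have "v < b \<bullet> y"
    using less t by (simp add: y_def field_simps inner_commute)
  ultimately show ?thesis
    by (auto simp: dual_feasible_def)
qed

lemma strong_duality:
  fixes A :: "real^'n^'m"
  assumes "optimal_pair A b c x y"
  shows "c \<bullet> x \<le> b \<bullet> y"
proof (rule ccontr)
  assume "\<not> c \<bullet> x \<le> b \<bullet> y"
  then obtain y' where "y' \<in> dual_feasible A c" "b \<bullet> y < b \<bullet> y'"
    using assms dual_feasible_above_lower_value[of c A b x "b \<bullet> y"]
    by (auto simp: optimal_pair_def)
  then show False
    using assms by (auto simp: optimal_pair_def is_arg_max_def)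
qed

section \<open>From the duality gap to approximate optimality\<close>

definition lagrangian :: "real^'n^'m \<Rightarrow> real^'m \<Rightarrow> real^'n \<Rightarrow> real^'n \<Rightarrow> real^'m \<Rightarrow> real" where
  "lagrangian A b c x y = c \<bullet> x + b \<bullet> y - y \<bullet> (A *v x)"

lemma lagrangian_primal:
  "lagrangian A b c x y = (c - transpose A *v y) \<bullet> x + b \<bullet> y"
  unfolding lagrangian_def inner_diff_left inner_transpose_matrix_vector by simp

lemma lagrangian_dual:
  "lagrangian A b c x y = c \<bullet> x + (b - A *v x) \<bullet> y"
  by (simp add: lagrangian_def inner_diff_left inner_commute[of y])

definition dual_violation :: "real^'n^'m \<Rightarrow> real^'n \<Rightarrow> real^'m \<Rightarrow> real" where
  "dual_violation A c y = max 0 (MAX j. axis j 1 \<bullet> (transpose A *v y - c))"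

lemma dual_violation_nonneg: "0 \<le> dual_violation A c y"
  by (simp add: dual_violation_def)

lemma dual_violation_ge: "(transpose A *v y - c) $ j \<le> dual_violation A c y"
proof -
  have "(transpose A *v y - c) $ j = axis j 1 \<bullet> (transpose A *v y - c)"
    by (simp only: inner_axis' inner_real_def mult_1)
  also have "\<dots> \<le> (MAX j. axis j 1 \<bullet> (transpose A *v y - c))"
    by (rule Max_ge) auto
  finally show ?thesis
    by (simp add: dual_violation_def)
qed

lemma norm1_nonneg: "0 \<le> norm1 v"
  by (simp add: norm1_def sum_nonneg)

lemma inner_le_infnorm_norm1: "w \<bullet> z \<le> infnorm w * norm1 z"
proof -
  have "w $ i * z $ i \<le> infnorm w * \<bar>z $ i\<bar>" for i
  proof -
    have "w $ i * z $ i \<le> \<bar>w $ i\<bar> * \<bar>z $ i\<bar>"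
      by (metis abs_ge_self abs_mult)
    also have "\<dots> \<le> infnorm w * \<bar>z $ i\<bar>"
      by (intro mult_right_mono component_le_infnorm_cart) simp
    finally show ?thesis .
  qed
  then show ?thesis
    by (simp add: inner_vec_def norm1_def sum_distrib_left sum_mono)
qed

lemma inner_le_dual_violation:
  assumes "0 \<le> x"
  shows "(transpose A *v y - c) \<bullet> x \<le> norm1 x * dual_violation A c y"
proof -
  have "(transpose A *v y - c) $ j * x $ j \<le> \<bar>x $ j\<bar> * dual_violation A c y" for j
    using assms mult_left_mono[OF dual_violation_ge[of A y c j], of "x $ j"]
    by (simp add: less_eq_vec_def mult.commute)
  then show ?thesis
    unfolding inner_vec_def norm1_def sum_distrib_right by (intro sum_mono) simp
qed

lemma dual_violation_attained:
  fixes A :: "real^'n^'m"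
  assumes "0 < \<xi>"
  shows "\<exists>u\<in>Delta \<xi>. (transpose A *v y - c) \<bullet> u = \<xi> * dual_violation A c y"
proof (cases "dual_violation A c y = 0")
  case True
  then show ?thesis
    using assms by (auto simp: Delta_def intro!: bexI[of _ 0])
next
  case False
  have "(MAX j. axis j 1 \<bullet> (transpose A *v y - c)) \<in> range (\<lambda>j. axis j 1 \<bullet> (transpose A *v y - c))"
    by (rule Max_in) auto
  then obtain j where "(MAX j. axis j 1 \<bullet> (transpose A *v y - c)) = axis j 1 \<bullet> (transpose A *v y - c)"
    by blast
  then have "dual_violation A c y = axis j 1 \<bullet> (transpose A *v y - c)"
    using False unfolding dual_violation_def by linarith
  moreover have "\<xi> *\<^sub>R axis j 1 \<in> Delta \<xi>"
    using assms by (auto simp: Delta_def less_eq_vec_def axis_def inner_axis vec_def)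
      (simp add: inner_vec_def if_distrib cong: if_cong)
  ultimately show ?thesis
    by (metis inner_commute inner_scaleR_right)
qed

lemma norm1_attained:
  assumes "0 < \<eta>"
  shows "\<exists>v\<in>Gamma_box \<eta>. z \<bullet> v = \<eta> * norm1 z"
proof -
  define v where "v = (\<chi> i. \<eta> * sgn (z $ i))"
  have "v \<in> Gamma_box \<eta>"
    using assms by (auto simp: Gamma_box_def mem_box_cart v_def sgn_if)
  moreover have "z \<bullet> v = \<eta> * norm1 z"
    unfolding v_def inner_vec_def norm1_def sum_distrib_left
    by (intro sum.cong) (simp_all add: sgn_if)
  ultimately show ?thesis
    by blast
qed

text \<open>
  The best responses to \<open>x\<close> and \<open>y\<close> turn the gap into the penalty function
  \<open>c \<bullet> x - b \<bullet> y + \<eta> N + \<xi> V\<close>, which therefore is at most \<open>\<delta>\<close>. Strong duality gives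
  \<open>c \<bullet> x - b \<bullet> y \<ge> - \<eta> N / 2 - \<xi> V / 2\<close>, so that \<open>\<eta> N + \<xi> V \<le> 2 \<delta>\<close>.
\<close>
lemma eps_optimal_if_gap_le:
  fixes A :: "real^'n^'m" and b :: "real^'m" and c x x_opt :: "real^'n" and y y_opt :: "real^'m"
  assumes opt: "optimal_pair A b c x_opt y_opt"
    and \<xi>: "0 < \<xi>" "2 * norm1 x_opt \<le> \<xi>"
    and \<eta>: "0 < \<eta>" "2 * infnorm y_opt \<le> \<eta>"
    and x: "0 \<le> x"
    and gap: "\<And>u v. u \<in> Delta \<xi> \<Longrightarrow> v \<in> Gamma_box \<eta> \<Longrightarrow>
      lagrangian A b c x v - lagrangian A b c u y \<le> \<delta>"
    and \<delta>: "\<delta> * (1 + 2 / \<xi> + 2 / \<eta>) \<le> \<epsilon>"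
  shows "eps_optimal A b c \<epsilon> x y"
proof -
  define N where "N = norm1 (b - A *v x)"
  define V where "V = dual_violation A c y"
  have N: "0 \<le> N" and V: "0 \<le> V"
    by (auto simp: N_def V_def norm1_nonneg dual_violation_nonneg)
  have xo: "0 \<le> x_opt" "A *v x_opt = b" and yo: "0 \<le> c - transpose A *v y_opt"
    using opt by (auto simp: optimal_pair_def is_arg_min_def is_arg_max_def primal_feasible_def
        dual_feasible_def less_eq_vec_def)
  obtain u where u: "u \<in> Delta \<xi>" "(transpose A *v y - c) \<bullet> u = \<xi> * V"
    using dual_violation_attained[OF \<xi>(1)] unfolding V_def by blast
  obtain v where v: "v \<in> Gamma_box \<eta>" "(b - A *v x) \<bullet> v = \<eta> * N"
    using norm1_attained[OF \<eta>(1)] unfolding N_def by blast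
  have "lagrangian A b c u y = b \<bullet> y - \<xi> * V"
    using u(2) by (simp add: lagrangian_primal inner_diff_left)
  moreover have "lagrangian A b c x v = c \<bullet> x + \<eta> * N"
    using v(2) by (simp add: lagrangian_dual)
  ultimately have upper: "c \<bullet> x - b \<bullet> y + \<eta> * N + \<xi> * V \<le> \<delta>"
    using gap[OF u(1) v(1)] by simp
  \<comment> \<open>Weak duality against the optimal pair, with infeasibility priced by the optimal multipliers.\<close>
  have "b \<bullet> y_opt - \<eta> / 2 * N \<le> c \<bullet> x"
  proof -
    have "0 \<le> (c - transpose A *v y_opt) \<bullet> x"
      using yo x by (rule inner_nonneg_vec)
    then have "y_opt \<bullet> (A *v x) \<le> c \<bullet> x"
      using inner_transpose_matrix_vector[of A y_opt x] by (simp add: inner_diff_left)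
    moreover have "y_opt \<bullet> (b - A *v x) \<le> infnorm y_opt * N"
      unfolding N_def by (rule inner_le_infnorm_norm1)
    moreover have "infnorm y_opt * N \<le> \<eta> / 2 * N"
      using \<eta> N by (intro mult_right_mono) auto
    ultimately show ?thesis
      by (simp add: inner_diff_right inner_commute)
  qed
  moreover have "b \<bullet> y \<le> c \<bullet> x_opt + \<xi> / 2 * V"
  proof -
    have "(transpose A *v y - c) \<bullet> x_opt \<le> norm1 x_opt * V"
      unfolding V_def using xo(1) by (rule inner_le_dual_violation)
    moreover have "norm1 x_opt * V \<le> \<xi> / 2 * V"
      using \<xi> V by (intro mult_right_mono) auto
    moreover have "(transpose A *v y) \<bullet> x_opt = b \<bullet> y"
      using inner_transpose_matrix_vector[of A y x_opt] xo(2) by (simp add: inner_commute)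
    ultimately show ?thesis
      by (simp add: inner_diff_left)
  qed
  ultimately have lower: "- (\<eta> / 2 * N) - \<xi> / 2 * V \<le> c \<bullet> x - b \<bullet> y"
    using strong_duality[OF opt] by linarith
  have nn: "0 \<le> \<eta> * N" "0 \<le> \<xi> * V"
    using \<xi> \<eta> N V by auto
  have sum: "\<eta> / 2 * N + \<xi> / 2 * V \<le> \<delta>"
    using upper lower by (simp add: field_simps)
  have d0: "0 \<le> \<delta>"
    using sum nn by simp
  have split: "\<delta> + 2 * \<delta> / \<xi> + 2 * \<delta> / \<eta> \<le> \<epsilon>"
    using \<delta> by (simp add: field_simps)
  have q: "0 \<le> 2 * \<delta> / \<xi>" "0 \<le> 2 * \<delta> / \<eta>"
    using d0 \<xi> \<eta> by auto
  have "N \<le> 2 * \<delta> / \<eta>" "V \<le> 2 * \<delta> / \<xi>"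
    using sum nn \<xi>(1) \<eta>(1) by (auto simp: field_simps)
  then have "N \<le> \<epsilon>" "V \<le> \<epsilon>" "c \<bullet> x - b \<bullet> y \<le> \<epsilon>"
    using split q d0 upper nn by linarith+
  then show ?thesis
    using x unfolding eps_optimal_def N_def V_def dual_violation_def by blast
qed

section \<open>Convergence of the averaged iterates\<close>

text \<open>
  The objective is a quadratic with leading coefficient \<open>a / 2\<close> along every line, and its slope at
  the minimizer towards any point of the convex set is nonnegative.
\<close>
lemma regularized_minimum_growth:
  fixes g :: "'a::real_inner"
  assumes conv: "convex S" and a: "0 \<le> a"
    and min: "is_arg_min (\<lambda>u. g \<bullet> u + a / 2 * (norm u)\<^sup>2) (\<lambda>u. u \<in> S) r"
    and u: "u \<in> S"
  shows "g \<bullet> r + a / 2 * (norm r)\<^sup>2 + a / 2 * (norm (u - r))\<^sup>2 \<le> g \<bullet> u + a / 2 * (norm u)\<^sup>2"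
proof -
  define d where "d = u - r"
  define p where "p = (g + a *\<^sub>R r) \<bullet> d"
  define q where "q = a / 2 * (norm d)\<^sup>2"
  have r: "r \<in> S" and le: "\<And>z. z \<in> S \<Longrightarrow>
      g \<bullet> r + a / 2 * (norm r)\<^sup>2 \<le> g \<bullet> z + a / 2 * (norm z)\<^sup>2"
    using min by (auto simp: is_arg_min_linorder)
  have expand: "g \<bullet> (r + t *\<^sub>R d) + a / 2 * (norm (r + t *\<^sub>R d))\<^sup>2
      = g \<bullet> r + a / 2 * (norm r)\<^sup>2 + t * p + t\<^sup>2 * q" for t
    unfolding p_def q_def power2_norm_eq_inner
    by (simp add: inner_add_left inner_add_right inner_commute algebra_simps power2_eq_square)
  have nonneg: "0 \<le> p + t * q" if t: "0 < t" "t \<le> 1" for t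
  proof -
    have "(1 - t) *\<^sub>R r + t *\<^sub>R u \<in> S"
      using conv r u t by (simp add: convexD)
    then have "r + t *\<^sub>R d \<in> S"
      by (simp add: d_def algebra_simps)
    then have "0 \<le> t * p + t\<^sup>2 * q"
      using le[of "r + t *\<^sub>R d"] expand[of t] by simp
    then have "0 \<le> t * (p + t * q)"
      by (simp add: power2_eq_square algebra_simps)
    then show ?thesis
      using t by (simp add: zero_le_mult_iff)
  qed
  have "((\<lambda>t. p + t * q) \<longlongrightarrow> p + 0 * q) (at_right 0)"
    by (intro tendsto_intros)
  moreover have "\<forall>\<^sub>F t in at_right 0. 0 \<le> p + t * q"
    unfolding eventually_at_right_field using nonneg by (intro exI[of _ 1]) auto
  ultimately have "0 \<le> p"
    using tendsto_lowerbound[of "\<lambda>t. p + t * q" "p + 0 * q" "at_right 0" 0] by simp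
  then show ?thesis
    using expand[of 1] by (simp add: q_def d_def)
qed

lemma convex_Delta: "convex (Delta \<xi> :: (real^'n) set)"
proof -
  have eq: "Delta \<xi> = (\<Inter>i. {x :: real^'n. axis i 1 \<bullet> x \<ge> 0}) \<inter> {x. vec 1 \<bullet> x \<le> \<xi>}"
    by (auto simp: Delta_def less_eq_vec_def inner_axis')
  show ?thesis
    unfolding eq by (intro convex_Int convex_INT convex_halfspace_ge convex_halfspace_le)
qed

lemma norm_le_if_Delta:
  assumes "u \<in> Delta \<xi>"
  shows "norm u \<le> \<xi>"
proof -
  have "norm u \<le> (\<Sum>i\<in>UNIV. \<bar>u $ i\<bar>)"
    by (rule norm_le_l1_cart)
  also have "\<dots> = vec 1 \<bullet> u"
    using assms by (simp add: inner_vec_def Delta_def less_eq_vec_def)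
  finally show ?thesis
    using assms by (simp add: Delta_def)
qed

lemma lagrangian_average_primal:
  fixes x r :: "real^'n"
  shows
  "real (k + 1) * lagrangian A b c ((real k / real (k + 1)) *\<^sub>R x + (1 / real (k + 1)) *\<^sub>R r) y
    = real k * lagrangian A b c x y + lagrangian A b c r y"
  proof -
  have "q * (g \<bullet> (((q - 1) / q) *\<^sub>R x + (1 / q) *\<^sub>R r) + e) = (q - 1) * (g \<bullet> x + e) + (g \<bullet> r + e)"
    if "q \<noteq> 0" for q e and g :: "real^'n"
    using that by (simp add: inner_add_right field_simps)
  from this[of "real (k + 1)"] show ?thesis
    unfolding lagrangian_primal by simp
qed

lemma lagrangian_average_dual:
  fixes y s :: "real^'m"
  shows
  "real (k + 1) * lagrangian A b c x ((real k / real (k + 1)) *\<^sub>R y + (1 / real (k + 1)) *\<^sub>R s)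
    = real k * lagrangian A b c x y + lagrangian A b c x s"
  proof -
  have "q * (e + g \<bullet> (((q - 1) / q) *\<^sub>R y + (1 / q) *\<^sub>R s)) = (q - 1) * (e + g \<bullet> y) + (e + g \<bullet> s)"
    if "q \<noteq> 0" for q e and g :: "real^'m"
    using that by (simp add: inner_add_right field_simps)
  from this[of "real (k + 1)"] show ?thesis
    unfolding lagrangian_dual by simp
qed

text \<open>
  The subproblem objective \<open>L(u, y\<^sub>k) + \<parallel>u\<parallel>\<^sup>2 / (2 \<surd>k)\<close> is scaled by \<open>k\<close>, which makes it
  an accumulated cost whose regularizer grows with \<open>k\<close>.
\<close>
lemma fwlp_p_primal_growth:
  fixes x r :: "nat \<Rightarrow> real^'n" and y s :: "nat \<Rightarrow> real^'m"
  assumes it: "fwlp_p_iterates A b c \<xi> \<eta> x y r s" and k: "1 \<le> k" and u: "u \<in> Delta \<xi>"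
  shows "real k * lagrangian A b c (r (k + 1)) (y k) + sqrt (real k) / 2 * (norm (r (k + 1)))\<^sup>2
      + sqrt (real k) / 2 * (norm (u - r (k + 1)))\<^sup>2
    \<le> real k * lagrangian A b c u (y k) + sqrt (real k) / 2 * (norm u)\<^sup>2"
proof -
  define a where "a = 1 / sqrt (real k)"
  have ka: "real k * (a / 2) = sqrt (real k) / 2"
    using k by (simp add: a_def real_div_sqrt)
  have "is_arg_min (\<lambda>u. (c - transpose A *v y k) \<bullet> u + (norm u)\<^sup>2 / (2 * sqrt (real k)))
      (\<lambda>u. u \<in> Delta \<xi>) (r (k + 1))"
    using it k by (auto simp: fwlp_p_iterates_def)
  then have "is_arg_min (\<lambda>u. (c - transpose A *v y k) \<bullet> u + a / 2 * (norm u)\<^sup>2)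
      (\<lambda>u. u \<in> Delta \<xi>) (r (k + 1))"
    by (simp add: a_def mult.commute)
  from regularized_minimum_growth[OF convex_Delta _ this u]
  have "(c - transpose A *v y k) \<bullet> r (k + 1) + a / 2 * (norm (r (k + 1)))\<^sup>2
      + a / 2 * (norm (u - r (k + 1)))\<^sup>2
    \<le> (c - transpose A *v y k) \<bullet> u + a / 2 * (norm u)\<^sup>2"
    by (simp add: a_def)
  then have "lagrangian A b c (r (k + 1)) (y k) + a / 2 * (norm (r (k + 1)))\<^sup>2
      + a / 2 * (norm (u - r (k + 1)))\<^sup>2
    \<le> lagrangian A b c u (y k) + a / 2 * (norm u)\<^sup>2"
    by (simp add: lagrangian_primal)
  from mult_left_mono[OF this, of "real k"] show ?thesis
    unfolding distrib_left mult.assoc[symmetric] ka by simp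
qed

lemma fwlp_p_dual_max:
  fixes x r :: "nat \<Rightarrow> real^'n" and y s :: "nat \<Rightarrow> real^'m"
  assumes it: "fwlp_p_iterates A b c \<xi> \<eta> x y r s" and k: "1 \<le> k" and v: "v \<in> Gamma_box \<eta>"
  shows "real (k + 1) * lagrangian A b c (x (k + 1)) v
      - real (k + 1) / sqrt (real k) / 2 * (norm v)\<^sup>2
    \<le> real (k + 1) * lagrangian A b c (x (k + 1)) (s (k + 1))
      - real (k + 1) / sqrt (real k) / 2 * (norm (s (k + 1)))\<^sup>2"
proof -
  have "is_arg_max (\<lambda>u. (b - A *v x (k + 1)) \<bullet> u - (norm u)\<^sup>2 / (2 * sqrt (real k)))
      (\<lambda>u. u \<in> Gamma_box \<eta>) (s (k + 1))"
    using it k by (auto simp: fwlp_p_iterates_def)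
  then have "lagrangian A b c (x (k + 1)) v - (norm v)\<^sup>2 / (2 * sqrt (real k))
      \<le> lagrangian A b c (x (k + 1)) (s (k + 1)) - (norm (s (k + 1)))\<^sup>2 / (2 * sqrt (real k))"
    using v by (auto simp: is_arg_max_linorder lagrangian_dual)
  from mult_left_mono[OF this, of "real (k + 1)"] show ?thesis
    unfolding right_diff_distrib by (simp add: mult.commute)
qed

text \<open>
  The regularization weight of the subproblem that produces \<open>s\<^sub>k\<close>, after scaling by \<open>k\<close>. No
  such subproblem exists for \<open>k = 1\<close>; there division by zero gives weight 0, which
  lets the potential argument start at the arbitrary point \<open>y\<^sub>1\<close>.
\<close>
definition dual_weight :: "nat \<Rightarrow> real" where
  "dual_weight k = real k / sqrt (real k - 1)"

lemma dual_weight_Suc: "dual_weight (k + 1) = real (k + 1) / sqrt (real k)"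
  by (simp add: dual_weight_def)

lemma dual_weight_mono: "dual_weight k \<le> dual_weight (k + 1)" if "1 \<le> k"
proof (cases "k = 1")
  case True
  then show ?thesis
    by (simp add: dual_weight_def)
next
  case False
  with that have k: "2 \<le> real k"
    by simp
  have "real k + 1 \<le> real k * real k"
    using mult_left_mono[OF k, of "real k"] k by linarith
  then have "real k ^ 3 \<le> (real k + 1)\<^sup>2 * (real k - 1)"
    by (simp add: power2_eq_square power3_eq_cube algebra_simps)
  then have "sqrt ((real k)\<^sup>2 * real k) \<le> sqrt ((real k + 1)\<^sup>2 * (real k - 1))"
    by (simp add: power2_eq_square power3_eq_cube)
  then have "real k * sqrt (real k) \<le> (real k + 1) * sqrt (real k - 1)"
    by (simp add: real_sqrt_mult)
  then show ?thesis
    using k by (simp add: dual_weight_def field_simps)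
qed

lemma dual_weight_le: "dual_weight k \<le> 2 * sqrt (real k)"
proof (cases "k \<le> 1")
  case True
  then have "k = 0 \<or> k = 1"
    by auto
  then show ?thesis
    by (auto simp: dual_weight_def)
next
  case False
  then have k: "2 \<le> real k"
    by simp
  then have "sqrt (real k) \<le> sqrt (4 * (real k - 1))"
    by simp
  then have "sqrt (real k) \<le> 2 * sqrt (real k - 1)"
    unfolding real_sqrt_mult real_sqrt_four .
  then have "sqrt (real k) * sqrt (real k) \<le> sqrt (real k) * (2 * sqrt (real k - 1))"
    by (rule mult_left_mono) simp
  then have "real k \<le> 2 * sqrt (real k) * sqrt (real k - 1)"
    by (simp add: algebra_simps)
  then show ?thesis
    using k by (simp add: dual_weight_def field_simps)
qed

text \<open>
  Telescoping, the sum of \<open>1 / (2 \<surd>j)\<close> over \<open>j < k\<close> is at most \<open>2 \<surd>k\<close>.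
\<close>
lemma inverse_sqrt_le_increment:
  assumes "1 \<le> k"
  shows "1 / (2 * sqrt (real k)) \<le> 2 * (sqrt (real (k + 1)) - sqrt (real k))"
proof -
  define p q where "p = sqrt (real k)" and "q = sqrt (real (k + 1))"
  have p: "0 < p"
    using assms by (simp add: p_def)
  have "q \<le> sqrt (4 * real k)"
    unfolding q_def using assms by (intro real_sqrt_le_mono) simp
  then have q: "q \<le> 2 * p"
    by (simp add: p_def real_sqrt_mult)
  have "p < q"
    by (simp add: p_def q_def)
  have "1 = (q - p) * (q + p)"
    by (simp add: p_def q_def algebra_simps)
  also have "\<dots> \<le> (q - p) * (4 * p)"
    using q p \<open>p < q\<close> by (intro mult_left_mono) auto
  finally show ?thesis
    using p unfolding p_def[symmetric] q_def[symmetric] by (simp add: field_simps)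
qed

lemma linear_minus_quadratic_le:
  assumes "0 < (a::real)"
  shows "M * d - a / 2 * d\<^sup>2 \<le> M\<^sup>2 * (1 / (2 * a))"
proof -
  have "0 \<le> (M - a * d)\<^sup>2 / (2 * a)"
    using assms by simp
  also have "\<dots> = M\<^sup>2 * (1 / (2 * a)) - (M * d - a / 2 * d\<^sup>2)"
    using assms by (simp add: power2_eq_square field_simps)
  finally show ?thesis
    by simp
qed

text \<open>
  The induction behind the convergence rate. The point \<open>v\<close> stays arbitrary because the step applies
  the induction hypothesis at \<open>s\<^sub>k\<^sub>+\<^sub>1\<close>, the dual maximizer one step later. Both
  regularization weights increase with \<open>k\<close>, so replacing old by new weights goes in the
  favourable direction.
\<close>
lemma fwlp_p_potential:
  fixes A :: "real^'n^'m" and x r :: "nat \<Rightarrow> real^'n" and y s :: "nat \<Rightarrow> real^'m"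
  assumes it: "fwlp_p_iterates A b c \<xi> \<eta> x y r s"
    and M: "\<And>v. v \<in> Gamma_box \<eta> \<Longrightarrow> norm (c - transpose A *v v) \<le> M"
    and B: "\<And>u v. u \<in> Delta \<xi> \<Longrightarrow> v \<in> Gamma_box \<eta> \<Longrightarrow>
      lagrangian A b c (x 1) v - lagrangian A b c u (y 1) \<le> B"
    and k: "1 \<le> k" and v: "v \<in> Gamma_box \<eta>"
  shows "real k * (lagrangian A b c (x k) v - lagrangian A b c (r (k + 1)) (y k))
      - dual_weight k / 2 * (norm v)\<^sup>2 - sqrt (real k) / 2 * (norm (r (k + 1)))\<^sup>2
    \<le> B + 2 * M\<^sup>2 * sqrt (real k)"
  using k v
proof (induction k arbitrary: v rule: dec_induct)
  case base
  have "r (1 + 1) \<in> Delta \<xi>"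
    using it unfolding fwlp_p_iterates_def is_arg_min_def by blast
  from B[OF this base] have "lagrangian A b c (x 1) v - lagrangian A b c (r (1 + 1)) (y 1) \<le> B" .
  moreover have "0 \<le> (norm (r (1 + 1)))\<^sup>2 / 2" "0 \<le> 2 * M\<^sup>2"
    by auto
  moreover have "dual_weight 1 = 0"
    by (simp add: dual_weight_def)
  ultimately show ?case
    by (simp only: of_nat_1 real_sqrt_one mult_1 mult_1_right)
next
  case (step k)
  let ?L = "lagrangian A b c"
  define r' s' r'' where "r' = r (k + 1)" and "s' = s (k + 1)" and "r'' = r (k + 2)"
  have k: "1 \<le> k"
    using step.hyps by simp
  have s': "s' \<in> Gamma_box \<eta>" and r'': "r'' \<in> Delta \<xi>"
    and x: "x (k + 1) = (real k / real (k + 1)) *\<^sub>R x k + (1 / real (k + 1)) *\<^sub>R r'"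
    and y: "y (k + 1) = (real k / real (k + 1)) *\<^sub>R y k + (1 / real (k + 1)) *\<^sub>R s'"
    using it k spec[OF it[unfolded fwlp_p_iterates_def], of "k + 1"]
    by (auto simp: fwlp_p_iterates_def is_arg_min_def is_arg_max_def r'_def s'_def r''_def)
  \<comment> \<open>Optimality of the new dual point, then expansion of the average that forms the new \<open>x\<close>.\<close>
  have dual: "real (k + 1) * ?L (x (k + 1)) v - dual_weight (k + 1) / 2 * (norm v)\<^sup>2
      \<le> real k * ?L (x k) s' + ?L r' s' - dual_weight k / 2 * (norm s')\<^sup>2"
  proof -
    have "dual_weight k / 2 * (norm s')\<^sup>2 \<le> dual_weight (k + 1) / 2 * (norm s')\<^sup>2"
      using dual_weight_mono[OF k] by (intro mult_right_mono) auto
    then show ?thesis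
      using fwlp_p_dual_max[OF it k step.prems] lagrangian_average_primal[of k A b c "x k" r' s']
      unfolding dual_weight_Suc[symmetric] s'_def[symmetric] x[symmetric] by linarith
  qed
  have primal: "real k * ?L r' (y k) + sqrt (real k) / 2 * (norm r')\<^sup>2
      + sqrt (real k) / 2 * (norm (r'' - r'))\<^sup>2 + ?L r'' s'
    \<le> real (k + 1) * ?L r'' (y (k + 1)) + sqrt (real (k + 1)) / 2 * (norm r'')\<^sup>2"
  proof -
    have "sqrt (real k) / 2 * (norm r'')\<^sup>2 \<le> sqrt (real (k + 1)) / 2 * (norm r'')\<^sup>2"
      by (intro mult_right_mono) auto
    then show ?thesis
      using fwlp_p_primal_growth[OF it k r''] lagrangian_average_dual[of k A b c r'' "y k" s']
      unfolding r'_def[symmetric] y[symmetric] by linarith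
  qed
  \<comment> \<open>The loss from choosing \<open>r'\<close> before \<open>s'\<close> is known is paid for by strong convexity.\<close>
  have "?L r' s' - ?L r'' s' - sqrt (real k) / 2 * (norm (r'' - r'))\<^sup>2
      \<le> 2 * M\<^sup>2 * (sqrt (real (k + 1)) - sqrt (real k))"
  proof -
    have "?L r' s' - ?L r'' s' = (c - transpose A *v s') \<bullet> (r' - r'')"
      by (simp add: lagrangian_primal inner_diff_right)
    also have "\<dots> \<le> norm (c - transpose A *v s') * norm (r' - r'')"
      by (rule norm_cauchy_schwarz)
    also have "\<dots> \<le> M * norm (r'' - r')"
      using M[OF s'] by (simp add: norm_minus_commute mult_right_mono)
    finally have "?L r' s' - ?L r'' s' - sqrt (real k) / 2 * (norm (r'' - r'))\<^sup>2
        \<le> M\<^sup>2 * (1 / (2 * sqrt (real k)))"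
      using linear_minus_quadratic_le[of "sqrt (real k)" M "norm (r'' - r')"] k by simp
    also have "\<dots> \<le> M\<^sup>2 * (2 * (sqrt (real (k + 1)) - sqrt (real k)))"
      by (intro mult_left_mono inverse_sqrt_le_increment k) simp
    finally show ?thesis
      by (simp only: mult.assoc mult.left_commute[of "M\<^sup>2" 2])
  qed
  moreover have "real k * (?L (x k) s' - ?L r' (y k))
      - dual_weight k / 2 * (norm s')\<^sup>2 - sqrt (real k) / 2 * (norm r')\<^sup>2
    \<le> B + 2 * M\<^sup>2 * sqrt (real k)"
    using step.IH[OF s'] by (simp add: r'_def)
  ultimately have "real (k + 1) * (?L (x (k + 1)) v - ?L r'' (y (k + 1)))
      - dual_weight (k + 1) / 2 * (norm v)\<^sup>2 - sqrt (real (k + 1)) / 2 * (norm r'')\<^sup>2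
    \<le> B + 2 * M\<^sup>2 * sqrt (real (k + 1))"
    using dual primal unfolding right_diff_distrib by linarith
  then show ?case
    by (simp add: r''_def)
qed

text \<open>
  The constant must be chosen before the iterates. It depends on them only through the starting
  point, because all later points enter the estimates through the bounded sets
  \<open>Delta \<xi>\<close> and \<open>Gamma_box \<eta>\<close>.
\<close>
lemma fwlp_p_gap:
  fixes A :: "real^'n^'m" and b :: "real^'m" and c x\<^sub>1 :: "real^'n" and y\<^sub>1 :: "real^'m"
  shows "\<exists>C>0. \<forall>x y r s. fwlp_p_iterates A b c \<xi> \<eta> x y r s \<and> x 1 = x\<^sub>1 \<and> y 1 = y\<^sub>1 \<longrightarrow>
    (\<forall>k\<ge>1. \<forall>u\<in>Delta \<xi>. \<forall>v\<in>Gamma_box \<eta>.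
      lagrangian A b c (x k) v - lagrangian A b c u (y k) \<le> C / sqrt (real k))"
proof -
  have "bounded (Gamma_box \<eta> :: (real^'m) set)"
    by (simp add: Gamma_box_def bounded_cbox)
  then obtain D where D: "\<And>v :: real^'m. v \<in> Gamma_box \<eta> \<Longrightarrow> norm v \<le> D"
    by (auto simp: bounded_iff)
  have "compact ((\<lambda>v. c - transpose A *v v) ` Gamma_box \<eta>)"
    unfolding Gamma_box_def
    by (intro compact_continuous_image compact_cbox continuous_intros)
  then obtain M where M: "\<And>v. v \<in> Gamma_box \<eta> \<Longrightarrow> norm (c - transpose A *v v) \<le> M"
    by (force dest!: compact_imp_bounded simp: bounded_iff)
  define B where "B = \<bar>c \<bullet> x\<^sub>1 - b \<bullet> y\<^sub>1\<bar> + norm (b - A *v x\<^sub>1) * \<bar>D\<bar> + norm (c - transpose A *v y\<^sub>1) * \<bar>\<xi>\<bar>"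
  have B0: "0 \<le> B"
    by (simp add: B_def)
  have B: "lagrangian A b c x\<^sub>1 v - lagrangian A b c u y\<^sub>1 \<le> B"
    if u: "u \<in> Delta \<xi>" and v: "v \<in> Gamma_box \<eta>" for u v
  proof -
    have "(b - A *v x\<^sub>1) \<bullet> v \<le> norm (b - A *v x\<^sub>1) * norm v"
      by (rule norm_cauchy_schwarz)
    also have "\<dots> \<le> norm (b - A *v x\<^sub>1) * \<bar>D\<bar>"
      using D[OF v] by (intro mult_left_mono) auto
    finally have 1: "(b - A *v x\<^sub>1) \<bullet> v \<le> norm (b - A *v x\<^sub>1) * \<bar>D\<bar>" .
    have "\<bar>(c - transpose A *v y\<^sub>1) \<bullet> u\<bar> \<le> norm (c - transpose A *v y\<^sub>1) * norm u"
      by (rule Cauchy_Schwarz_ineq2)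
    also have "\<dots> \<le> norm (c - transpose A *v y\<^sub>1) * \<bar>\<xi>\<bar>"
      using norm_le_if_Delta[OF u] by (intro mult_left_mono) auto
    finally show ?thesis
      using 1 unfolding B_def lagrangian_dual[of A b c x\<^sub>1] lagrangian_primal[of A b c u]
      by linarith
  qed
  define C where "C = B + 2 * M\<^sup>2 + D\<^sup>2 + \<xi>\<^sup>2 / 2 + 1"
  have "0 < C"
    using B0 by (simp add: C_def add_nonneg_pos)
  moreover have "lagrangian A b c (x k) v - lagrangian A b c u (y k) \<le> C / sqrt (real k)"
    if it: "fwlp_p_iterates A b c \<xi> \<eta> x y r s" and x1: "x 1 = x\<^sub>1" "y 1 = y\<^sub>1"
      and k: "1 \<le> k" and u: "u \<in> Delta \<xi>" and v: "v \<in> Gamma_box \<eta>" for x y r s k u v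
  proof -
    let ?gap = "lagrangian A b c (x k) v - lagrangian A b c u (y k)"
    have k1: "1 \<le> sqrt (real k)"
      using k by simp
    have pot: "real k * (lagrangian A b c (x k) v - lagrangian A b c (r (k + 1)) (y k))
        - dual_weight k / 2 * (norm v)\<^sup>2 - sqrt (real k) / 2 * (norm (r (k + 1)))\<^sup>2
      \<le> B + 2 * M\<^sup>2 * sqrt (real k)"
      by (rule fwlp_p_potential[OF it M _ k v]) (use B x1 in auto)
    have growth: "real k * lagrangian A b c (r (k + 1)) (y k) + sqrt (real k) / 2 * (norm (r (k + 1)))\<^sup>2
      \<le> real k * lagrangian A b c u (y k) + sqrt (real k) / 2 * (norm u)\<^sup>2"
      using fwlp_p_primal_growth[OF it k u]
      by (smt (verit) k1 divide_nonneg_nonneg mult_nonneg_nonneg zero_le_power2)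
    have "dual_weight k / 2 * (norm v)\<^sup>2 \<le> sqrt (real k) * D\<^sup>2"
      using dual_weight_le[of k] D[OF v] by (intro mult_mono power_mono) auto
    moreover have "sqrt (real k) / 2 * (norm u)\<^sup>2 \<le> sqrt (real k) / 2 * \<xi>\<^sup>2"
      using norm_le_if_Delta[OF u] by (intro mult_left_mono power_mono) auto
    moreover have "B + 1 \<le> sqrt (real k) * (B + 1)"
      using mult_right_mono[OF k1, of "B + 1"] B0 by simp
    ultimately have "real k * ?gap \<le> sqrt (real k) * C"
      using pot growth unfolding right_diff_distrib C_def distrib_left by (simp add: algebra_simps)
    then have "sqrt (real k) * (sqrt (real k) * ?gap) \<le> sqrt (real k) * C"
      by (simp add: mult.assoc[symmetric])
    then have "sqrt (real k) * ?gap \<le> C"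
      using k1 by (subst (asm) mult_le_cancel_left_pos) auto
    then show ?thesis
      using k1 by (simp add: field_simps)
  qed
  ultimately show ?thesis
    by blast
qed

lemma fwlp_p_primal_nonneg:
  fixes x r :: "nat \<Rightarrow> real^'n" and y s :: "nat \<Rightarrow> real^'m"
  assumes it: "fwlp_p_iterates A b c \<xi> \<eta> x y r s" and "0 \<le> x 1" and "1 \<le> k"
  shows "0 \<le> x k"
  using \<open>1 \<le> k\<close>
proof (induction k rule: dec_induct)
  case base
  show ?case
    by (fact \<open>0 \<le> x 1\<close>)
next
  case (step k)
  have "r (k + 1) \<in> Delta \<xi>"
    and "x (k + 1) = (real k / real (k + 1)) *\<^sub>R x k + (1 / real (k + 1)) *\<^sub>R r (k + 1)"
    using it step.hyps by (auto simp: fwlp_p_iterates_def is_arg_min_def)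
  then show ?case
    using step.IH by (auto simp: Delta_def less_eq_vec_def)
qed

theorem theorem3:
  fixes A :: "real^'n^'m" and b :: "real^'m" and c :: "real^'n"
    and x_opt x\<^sub>1 :: "real^'n" and y_opt y\<^sub>1 :: "real^'m" and \<xi> \<eta> :: real
  assumes "optimal_pair A b c x_opt y_opt"
    and "\<xi> > 0" and "\<eta> > 0"
    and "\<xi> \<ge> 2 * norm1 x_opt"
    and "\<eta> \<ge> 2 * infnorm y_opt"
    and "0 \<le> x\<^sub>1"
  shows "\<exists>K>0. \<forall>x y r s. fwlp_p_iterates A b c \<xi> \<eta> x y r s \<and> x 1 = x\<^sub>1 \<and> y 1 = y\<^sub>1 \<longrightarrow>
    (\<forall>\<epsilon>::real. 0 < \<epsilon> \<and> \<epsilon> \<le> 1 \<longrightarrow>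
      (\<forall>k::nat. real k \<ge> K / \<epsilon>\<^sup>2 \<longrightarrow> eps_optimal A b c \<epsilon> (x k) (y k)))"
proof -
  obtain C where C: "0 < C"
    and gap: "\<And>x y r s k u v. fwlp_p_iterates A b c \<xi> \<eta> x y r s \<Longrightarrow> x 1 = x\<^sub>1 \<Longrightarrow> y 1 = y\<^sub>1 \<Longrightarrow>
      1 \<le> k \<Longrightarrow> u \<in> Delta \<xi> \<Longrightarrow> v \<in> Gamma_box \<eta> \<Longrightarrow>
      lagrangian A b c (x k) v - lagrangian A b c u (y k) \<le> C / sqrt (real k)"
    using fwlp_p_gap[of A b c \<xi> \<eta> x\<^sub>1 y\<^sub>1] by blast
  define H where "H = C * (1 + 2 / \<xi> + 2 / \<eta>)"
  have H: "0 < H"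
    using C assms(2,3) by (simp add: H_def add_pos_pos)
  have "eps_optimal A b c \<epsilon> (x k) (y k)"
    if it: "fwlp_p_iterates A b c \<xi> \<eta> x y r s" and x1: "x 1 = x\<^sub>1" "y 1 = y\<^sub>1"
      and \<epsilon>: "0 < \<epsilon>" and large: "H\<^sup>2 / \<epsilon>\<^sup>2 \<le> real k" for x y r s \<epsilon> k
  proof (rule eps_optimal_if_gap_le[OF assms(1,2,4,3,5)])
    have "0 < H\<^sup>2 / \<epsilon>\<^sup>2"
      using H \<epsilon> by simp
    with large have "0 < real k"
      by linarith
    then have k: "1 \<le> k"
      by simp
    show "0 \<le> x k"
      using fwlp_p_primal_nonneg[OF it _ k] x1 assms(6) by simp
    show "lagrangian A b c (x k) v - lagrangian A b c u (y k) \<le> C / sqrt (real k)"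
      if "u \<in> Delta \<xi>" "v \<in> Gamma_box \<eta>" for u v
      using gap[OF it x1 k that] .
    have "(H / \<epsilon>)\<^sup>2 \<le> real k"
      using large by (simp add: power_divide)
    then have "H / \<epsilon> \<le> sqrt (real k)"
      by (rule real_le_rsqrt)
    then have "H / sqrt (real k) \<le> \<epsilon>"
      using \<epsilon> k by (simp add: field_simps)
    then show "C / sqrt (real k) * (1 + 2 / \<xi> + 2 / \<eta>) \<le> \<epsilon>"
      by (simp add: H_def)
  qed
  then show ?thesis
    using H by (intro exI[of _ "H\<^sup>2"]) auto
qed

end
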